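(* Let $(M,H,J,P)$ be a quadruple, where $M$ is a von Neumann algebra acting on a Hilbert space $H$, $J$ is an antilinear isometry on $H$ with $J^2=1$, and $P\subset H$ is a closed convex cone which is self-dual. Suppose that 1. $JMJ=M'$; 2. $J\xi=\xi$ for all $\xi\in P$; 3. $xJxJ(P)\subset P$ for all $x\in M$. Then $JxJ=x^*$ for all $x\in\mathcal{Z}(M)$, whence $(M,H,J,P)$ is a standard form.
   Context: Self-dual means $P=P^0:=\{\xi\in H:\ \langle\xi,\eta\rangle\ge 0\text{ for all }\eta\in P\}$. $\mathcal{Z}(M)$ denotes the center of $M$. A quadruple as in the claim is called a standard form if it satisfies 1.–3. together with: 4. $JxJ=x^*$ for all $x\in\mathcal{Z}(M)$. *)

theory Defs
  imports "HOL-Analysis.Analysis"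
begin

subsection \<open>Complex Hilbert spaces\<close>

class complex_vector = real_vector +
  fixes scaleC :: "complex \<Rightarrow> 'a \<Rightarrow> 'a" (infixr \<open>*\<^sub>C\<close> 75)
  assumes scaleC_add_right: "c *\<^sub>C (x + y) = c *\<^sub>C x + c *\<^sub>C y"
    and scaleC_add_left: "(c + d) *\<^sub>C x = c *\<^sub>C x + d *\<^sub>C x"
    and scaleC_scaleC: "c *\<^sub>C (d *\<^sub>C x) = (c * d) *\<^sub>C x"
    and scaleR_scaleC: "r *\<^sub>R x = complex_of_real r *\<^sub>C x"

text \<open>The inner product is linear in the first argument. Positive definiteness is contained
  in \<open>cinner_self\<close>, which says that the norm is the one induced by the inner product.\<close>

class complex_inner = complex_vector + real_normed_vector +
  fixes cinner :: "'a \<Rightarrow> 'a \<Rightarrow> complex"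
  assumes cinner_commute: "cinner x y = cnj (cinner y x)"
    and cinner_add_left: "cinner (x + y) z = cinner x z + cinner y z"
    and cinner_scaleC_left: "cinner (c *\<^sub>C x) y = c * cinner x y"
    and cinner_self: "cinner x x = complex_of_real ((norm x)\<^sup>2)"

class complex_hilbert_space = complex_inner + complete_space

instantiation complex :: complex_hilbert_space
begin

definition scaleC_complex :: "complex \<Rightarrow> complex \<Rightarrow> complex"
  where "scaleC_complex c x = c * x"

definition cinner_complex :: "complex \<Rightarrow> complex \<Rightarrow> complex"
  where "cinner_complex x y = x * cnj y"

instance
proof
  fix x :: complex
  show "cinner x x = complex_of_real ((norm x)\<^sup>2)"
    unfolding cinner_complex_def by (rule complex_norm_square[symmetric])
qed (auto simp: scaleC_complex_def cinner_complex_def algebra_simps scaleR_conv_of_real)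

end


subsection \<open>Bounded operators and von Neumann algebras\<close>

definition bounded_clinear :: "('h::complex_inner \<Rightarrow> 'h) \<Rightarrow> bool"
  where "bounded_clinear T \<longleftrightarrow> bounded_linear T \<and> (\<forall>c \<xi>. T (c *\<^sub>C \<xi>) = c *\<^sub>C T \<xi>)"

text \<open>For a bounded operator on a Hilbert space, the adjoint exists and is unique; see
  \<open>cinner_cadjoint\<close> and \<open>cadjoint_eqI\<close> below.\<close>

definition cadjoint :: "('h::complex_hilbert_space \<Rightarrow> 'h) \<Rightarrow> ('h \<Rightarrow> 'h)"
  where "cadjoint T = (THE S. \<forall>\<xi> \<eta>. cinner (T \<xi>) \<eta> = cinner \<xi> (S \<eta>))"

definition commutant :: "('h::complex_hilbert_space \<Rightarrow> 'h) set \<Rightarrow> ('h \<Rightarrow> 'h) set"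
  where "commutant M = {T. bounded_clinear T \<and> (\<forall>S\<in>M. T \<circ> S = S \<circ> T)}"

text \<open>A von Neumann algebra acting on \<open>H\<close> is a \<open>*\<close>-subalgebra of \<open>B(H)\<close> that coincides with its
  bicommutant; in particular it contains the identity operator.\<close>

definition von_neumann_algebra :: "('h::complex_hilbert_space \<Rightarrow> 'h) set \<Rightarrow> bool"
  where "von_neumann_algebra M \<longleftrightarrow>
    (\<forall>x\<in>M. bounded_clinear x) \<and>
    (\<forall>x\<in>M. \<forall>y\<in>M. (\<lambda>\<xi>. x \<xi> + y \<xi>) \<in> M) \<and>
    (\<forall>c. \<forall>x\<in>M. (\<lambda>\<xi>. c *\<^sub>C x \<xi>) \<in> M) \<and>
    (\<forall>x\<in>M. \<forall>y\<in>M. x \<circ> y \<in> M) \<and>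
    (\<forall>x\<in>M. cadjoint x \<in> M) \<and>
    commutant (commutant M) = M"

definition center :: "('h::complex_hilbert_space \<Rightarrow> 'h) set \<Rightarrow> ('h \<Rightarrow> 'h) set"
  where "center M = {x\<in>M. \<forall>y\<in>M. x \<circ> y = y \<circ> x}"


subsection \<open>Standard forms\<close>

definition antilinear_isometry :: "('h::complex_inner \<Rightarrow> 'h) \<Rightarrow> bool"
  where "antilinear_isometry J \<longleftrightarrow>
    (\<forall>\<xi> \<eta>. J (\<xi> + \<eta>) = J \<xi> + J \<eta>) \<and>
    (\<forall>c \<xi>. J (c *\<^sub>C \<xi>) = cnj c *\<^sub>C J \<xi>) \<and>
    (\<forall>\<xi>. norm (J \<xi>) = norm \<xi>)"

text \<open>A complex number is \<open>\<ge> 0\<close> if it is real and nonnegative.\<close>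

definition dual_cone :: "'h::complex_inner set \<Rightarrow> 'h set"
  where "dual_cone P = {\<xi>. \<forall>\<eta>\<in>P. cinner \<xi> \<eta> \<in> \<real>\<^sub>\<ge>\<^sub>0}"

definition self_dual :: "'h::complex_inner set \<Rightarrow> bool"
  where "self_dual P \<longleftrightarrow> P = dual_cone P"

text \<open>In a quadruple \<open>(M, H, J, P)\<close> the Hilbert space \<open>H\<close> is the whole type \<open>'h\<close>.\<close>

definition standard_form ::
    "('h::complex_hilbert_space \<Rightarrow> 'h) set \<Rightarrow> ('h \<Rightarrow> 'h) \<Rightarrow> 'h set \<Rightarrow> bool"
  where "standard_form M J P \<longleftrightarrow>
    von_neumann_algebra M \<and>
    antilinear_isometry J \<and> J \<circ> J = id \<and>
    closed P \<and> convex P \<and> cone P \<and> self_dual P \<and>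
    (\<lambda>x. J \<circ> x \<circ> J) ` M = commutant M \<and>
    (\<forall>\<xi>\<in>P. J \<xi> = \<xi>) \<and>
    (\<forall>x\<in>M. (x \<circ> J \<circ> x \<circ> J) ` P \<subseteq> P) \<and>
    (\<forall>x\<in>center M. J \<circ> x \<circ> J = cadjoint x)"


subsection \<open>Existence and uniqueness of the adjoint\<close>

lemma cinner_add_right: "cinner x (y + z) = cinner x y + cinner (x::'h::complex_inner) z"
  by (simp add: cinner_commute[of x] cinner_add_left)

lemma cinner_scaleC_right: "cinner x (c *\<^sub>C y) = cnj c * cinner (x::'h::complex_inner) y"
  by (simp add: cinner_commute[of x] cinner_scaleC_left)

lemma cinner_minus_right: "cinner x (- y) = - cinner (x::'h::complex_inner) y"
proof -
  have "cinner x 0 = 0"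
    using cinner_add_right[of x 0 0] by simp
  then have "cinner x y + cinner x (- y) = 0"
    using cinner_add_right[of x y "- y"] by simp
  then show ?thesis
    by (simp add: add_eq_0_iff)
qed

lemma cinner_diff_right: "cinner x (y - z) = cinner x y - cinner (x::'h::complex_inner) z"
  using cinner_add_right[of x y "- z"] by (simp add: cinner_minus_right)

lemma cinner_scaleR_left: "cinner (r *\<^sub>R x) y = of_real r * cinner (x::'h::complex_inner) y"
  by (simp add: scaleR_scaleC cinner_scaleC_left)

lemma cinner_scaleR_right: "cinner x (r *\<^sub>R y) = of_real r * cinner (x::'h::complex_inner) y"
  by (simp add: scaleR_scaleC cinner_scaleC_right)

lemma norm_add_square:
  "(norm (x + y))\<^sup>2 = (norm x)\<^sup>2 + (norm y)\<^sup>2 + 2 * Re (cinner x (y::'h::complex_inner))"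
proof -
  have "complex_of_real ((norm (x + y))\<^sup>2)
      = of_real ((norm x)\<^sup>2) + of_real ((norm y)\<^sup>2) + (cinner x y + cinner y x)"
    unfolding cinner_self[symmetric] by (simp add: cinner_add_left cinner_add_right)
  also have "cinner y x = cnj (cinner x y)"
    by (rule cinner_commute)
  finally have "Re (complex_of_real ((norm (x + y))\<^sup>2))
      = Re (of_real ((norm x)\<^sup>2) + of_real ((norm y)\<^sup>2) + (cinner x y + cnj (cinner x y)))"
    by simp
  then show ?thesis
    by (simp del: of_real_power)
qed

lemma norm_diff_square:
  "(norm (x - y))\<^sup>2 = (norm x)\<^sup>2 + (norm y)\<^sup>2 - 2 * Re (cinner x (y::'h::complex_inner))"
  using norm_add_square[of x "- y"] by (simp add: cinner_minus_right)

lemma Re_cinner_le: "Re (cinner x y) \<le> norm x * norm (y::'h::complex_inner)"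
proof -
  have "(norm (x + y))\<^sup>2 \<le> (norm x + norm y)\<^sup>2"
    by (intro power_mono norm_triangle_ineq norm_ge_zero)
  then show ?thesis
    by (simp add: norm_add_square power2_sum)
qed

lemma Re_cinner_eq: "Re (cinner x (y::'h::complex_inner)) = ((norm (x + y))\<^sup>2 - (norm (x - y))\<^sup>2) / 4"
  by (simp add: norm_add_square norm_diff_square)

lemma cinner_ext_right:
  fixes a b :: "'h::complex_inner"
  assumes "\<And>x. cinner x a = cinner x b"
  shows "a = b"
proof -
  have "cinner (a - b) (a - b) = 0"
    by (simp add: cinner_diff_right assms)
  then show ?thesis
    by (simp add: cinner_self)
qed

lemma cadjoint_eqI:
  assumes "\<And>\<xi> \<eta>. cinner (T \<xi>) \<eta> = cinner \<xi> (S \<eta>)"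
  shows "cadjoint T = S"
  unfolding cadjoint_def
proof (rule the_equality)
  show "\<forall>\<xi> \<eta>. cinner (T \<xi>) \<eta> = cinner \<xi> (S \<eta>)"
    using assms by blast
  show "S' = S" if "\<forall>\<xi> \<eta>. cinner (T \<xi>) \<eta> = cinner \<xi> (S' \<eta>)" for S'
  proof (rule ext, rule cinner_ext_right)
    show "cinner \<xi> (S' \<eta>) = cinner \<xi> (S \<eta>)" for \<xi> \<eta>
      using that assms[of \<xi> \<eta>] by simp
  qed
qed

text \<open>Riesz representation of \<open>\<xi> \<mapsto> \<langle>T \<xi>, \<eta>\<rangle>\<close>, by minimizing
  \<open>\<parallel>\<xi>\<parallel>\<^sup>2 - 2 Re \<langle>T \<xi>, \<eta>\<rangle>\<close>.\<close>

lemma adjoint_vector_exists: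
  fixes T :: "'h::complex_hilbert_space \<Rightarrow> 'h"
  assumes T: "bounded_clinear T"
  shows "\<exists>m. \<forall>x. cinner (T x) y = cinner x m"
proof -
  from T have bl: "bounded_linear T" and Tc: "\<And>c x. T (c *\<^sub>C x) = c *\<^sub>C T x"
    by (auto simp: bounded_clinear_def)
  interpret T: bounded_linear T by (rule bl)
  define f where "f = (\<lambda>x. Re (cinner (T x) y))"
  define \<phi> where "\<phi> = (\<lambda>x. (norm x)\<^sup>2 - 2 * f x)"
  have f_add: "f (a + b) = f a + f b" for a b
    by (simp add: f_def T.add cinner_add_left)
  have f_scale: "f (r *\<^sub>R a) = r * f a" for r a
    by (simp add: f_def T.scaleR cinner_scaleR_left)
  obtain K where K: "\<And>x. norm (T x) \<le> norm x * K"
    using T.bounded by blast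
  have lower: "\<phi> x \<ge> - (K * norm y)\<^sup>2" for x
  proof -
    have "f x \<le> norm (T x) * norm y"
      unfolding f_def by (rule Re_cinner_le)
    also have "\<dots> \<le> norm x * K * norm y"
      by (intro mult_right_mono K norm_ge_zero)
    finally have "f x \<le> norm x * (K * norm y)"
      by (simp add: mult.assoc)
    moreover have "0 \<le> (norm x - K * norm y)\<^sup>2"
      by simp
    ultimately show ?thesis
      unfolding \<phi>_def power2_diff by linarith
  qed
  define d where "d = Inf (range \<phi>)"
  have bdd: "bdd_below (range \<phi>)"
    using lower by (auto simp: bdd_below_def)
  have d_le: "d \<le> \<phi> x" for x
    unfolding d_def using bdd by (intro cInf_lower) auto
  have "\<exists>x. \<phi> x < d + 1 / real (Suc n)" for n
  proof -
    have "Inf (range \<phi>) < d + 1 / real (Suc n)"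
      by (simp add: d_def)
    then show ?thesis
      using cInf_less_iff[of "range \<phi>"] bdd by auto
  qed
  then obtain X where X: "\<And>n. \<phi> (X n) < d + 1 / real (Suc n)"
    by metis
  have par: "(norm (a - b))\<^sup>2 \<le> 2 * (\<phi> a - d) + 2 * (\<phi> b - d)" for a b
  proof -
    have "\<phi> ((1/2) *\<^sub>R (a + b)) = (norm (a + b))\<^sup>2 / 4 - (f a + f b)"
      by (simp only: \<phi>_def f_scale f_add norm_scaleR power_mult_distrib)
        (simp add: power2_eq_square add_divide_distrib)
    moreover have "d \<le> \<phi> ((1/2) *\<^sub>R (a + b))"
      by (rule d_le)
    ultimately have "d \<le> (norm (a + b))\<^sup>2 / 4 - (f a + f b)"
      by simp
    then show ?thesis
      unfolding \<phi>_def norm_add_square norm_diff_square by argo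
  qed
  have "Cauchy X"
  proof (rule metric_CauchyI)
    fix e :: real
    assume "e > 0"
    then obtain N where N: "1 / real (Suc N) < e\<^sup>2 / 4"
      using nat_approx_posE[of "e\<^sup>2 / 4"] by auto
    have small: "\<phi> (X n) - d < e\<^sup>2 / 4" if "n \<ge> N" for n
    proof -
      have "1 / real (Suc n) \<le> 1 / real (Suc N)"
        using that by (simp add: frac_le)
      then show ?thesis
        using X[of n] N by linarith
    qed
    have "dist (X m) (X n) < e" if "m \<ge> N" "n \<ge> N" for m n
    proof -
      have "(norm (X m - X n))\<^sup>2 < e\<^sup>2"
        using par[of "X m" "X n"] small[OF that(1)] small[OF that(2)] by argo
      then show ?thesis
        using \<open>e > 0\<close> by (simp add: dist_norm power_less_imp_less_base)
    qed
    then show "\<exists>N. \<forall>m\<ge>N. \<forall>n\<ge>N. dist (X m) (X n) < e"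
      by blast
  qed
  then obtain m where m: "X \<longlonglongrightarrow> m"
    using Cauchy_convergent convergent_def by blast
  have "(\<lambda>n. \<phi> (X n)) \<longlonglongrightarrow> \<phi> m"
    unfolding \<phi>_def f_def Re_cinner_eq
    by (intro tendsto_intros T.tendsto m) simp
  moreover have "(\<lambda>n. d + 1 / real (Suc n)) \<longlonglongrightarrow> d + 0"
    by (intro tendsto_intros LIMSEQ_Suc[OF lim_1_over_n])
  ultimately have "\<phi> m \<le> d + 0"
    by (rule LIMSEQ_le) (use X less_imp_le in blast)
  then have min: "\<phi> m \<le> \<phi> x" for x
    using d_le[of x] by simp
  have Re_eq: "Re (cinner v m) = f v" for v
  proof -
    define b where "b = Re (cinner m v) - f v"
    define s where "s = (norm v)\<^sup>2 + 1"
    have s: "s > 0"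
      by (simp add: s_def add_nonneg_pos)
    have quad: "0 \<le> t\<^sup>2 * (norm v)\<^sup>2 + 2 * t * b" for t
      using min[of "m + t *\<^sub>R v"]
      by (simp add: \<phi>_def f_add f_scale norm_add_square cinner_scaleR_right b_def
          power_mult_distrib algebra_simps)
    have "0 \<le> (- b / s)\<^sup>2 * (norm v)\<^sup>2 + 2 * (- b / s) * b"
      by (rule quad)
    also have "\<dots> \<le> (- b / s)\<^sup>2 * s + 2 * (- b / s) * b"
      by (intro add_right_mono mult_left_mono) (auto simp: s_def)
    also have "\<dots> = - (b\<^sup>2 / s)"
      using s by (simp add: field_simps power2_eq_square)
    finally have "b = 0"
      using s by (simp add: divide_le_0_iff)
    then show ?thesis
      unfolding b_def using cinner_commute[of v m] by simp
  qed
  have "cinner (T x) y = cinner x m" for x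
  proof (rule complex_eqI)
    show "Re (cinner (T x) y) = Re (cinner x m)"
      using Re_eq[of x] by (simp add: f_def)
    show "Im (cinner (T x) y) = Im (cinner x m)"
      using Re_eq[of "\<i> *\<^sub>C x"] by (simp add: f_def Tc cinner_scaleC_left)
  qed
  then show ?thesis
    by blast
qed

lemma cinner_cadjoint:
  assumes "bounded_clinear T"
  shows "cinner (T \<xi>) \<eta> = cinner \<xi> (cadjoint T \<eta>)"
proof -
  obtain S where S: "\<And>\<xi> \<eta>. cinner (T \<xi>) \<eta> = cinner \<xi> (S \<eta>)"
    using adjoint_vector_exists[OF assms] by metis
  then have "cadjoint T = S"
    by (rule cadjoint_eqI)
  then show ?thesis
    using S by simp
qed

end

theory Submission
  imports Defs
begin

text \<open>Let \<open>x\<close> be central. Then \<open>J x\<^sup>* J\<close> lies in \<open>M\<close>: the operator \<open>x\<^sup>*\<close> is in \<open>M'\<close>, and conjugation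
  by \<open>J\<close> maps \<open>M'\<close> back to \<open>M\<close>. So \<open>y = x - J x\<^sup>* J\<close> is in \<open>M\<close>, and it measures the failure of the
  claim. It is antisymmetric: \<open>J y J = J x J - x\<^sup>* = - y\<^sup>*\<close>. The positivity condition for
  \<open>y\<close> therefore says that \<open>- y y\<^sup>*\<close> maps the cone \<open>P\<close> to itself, and pairing \<open>- y y\<^sup>* \<xi> \<in> P\<close> with
  \<open>\<xi> \<in> P\<close> gives \<open>- \<parallel>y\<^sup>* \<xi>\<parallel>\<^sup>2 \<ge> 0\<close>. Hence \<open>y\<^sup>*\<close> vanishes on \<open>P\<close>, which means that the range of \<open>y\<close> is
  orthogonal to \<open>P\<close>. Only \<open>0\<close> is orthogonal to a self-dual cone
  (\<open>orthogonal_self_dual_eq_0\<close>), so \<open>y = 0\<close>.\<close>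

lemma antilinear_isometry_diff:
  assumes "antilinear_isometry J"
  shows "J (a - b) = J a - J b"
proof -
  have "J (a - b + b) = J (a - b) + J b"
    using assms by (simp only: antilinear_isometry_def)
  then show ?thesis
    by simp
qed

text \<open>Additivity and isometry determine the real part by polarization; antilinearity transfers
  this to the imaginary part, with the opposite sign.\<close>

lemma cinner_antilinear_isometry:
  assumes "antilinear_isometry J"
  shows "cinner (J a) (J b) = cnj (cinner a b)"
proof -
  have add: "\<And>a b. J (a + b) = J a + J b" and scale: "\<And>c a. J (c *\<^sub>C a) = cnj c *\<^sub>C J a"
    and norm: "\<And>a. norm (J a) = norm a"
    using assms by (auto simp: antilinear_isometry_def)
  have re: "Re (cinner (J a) (J b)) = Re (cinner a b)" for a b
    unfolding Re_cinner_eq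
    by (simp only: add[symmetric] antilinear_isometry_diff[OF assms, symmetric] norm)
  show ?thesis
  proof (rule complex_eqI)
    show "Re (cinner (J a) (J b)) = Re (cnj (cinner a b))"
      by (simp add: re)
    show "Im (cinner (J a) (J b)) = Im (cnj (cinner a b))"
      using re[of a "\<i> *\<^sub>C b"] by (simp add: scale cinner_scaleC_right)
  qed
qed

lemma cadjoint_conjugation:
  assumes J: "antilinear_isometry J" and JJ: "J \<circ> J = id" and T: "bounded_clinear T"
  shows "cinner (J (T (J \<xi>))) \<eta> = cinner \<xi> (J (cadjoint T (J \<eta>)))"
proof -
  have inv: "J (J a) = a" for a
    using fun_cong[OF JJ, of a] by simp
  have "cinner (J (T (J \<xi>))) (J (J \<eta>)) = cinner (J (J \<xi>)) (J (cadjoint T (J \<eta>)))"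
    by (simp only: cinner_antilinear_isometry[OF J] cinner_cadjoint[OF T])
  then show ?thesis
    by (simp only: inv)
qed

text \<open>A vector orthogonal to the cone belongs to the dual cone, that is, to the cone, and is
  then orthogonal to itself.\<close>

lemma orthogonal_self_dual_eq_0:
  assumes "self_dual P" and "\<And>\<xi>. \<xi> \<in> P \<Longrightarrow> cinner v \<xi> = 0"
  shows "v = 0"
proof -
  have "v \<in> P"
    using assms by (auto simp: self_dual_def dual_cone_def)
  then have "cinner v v = 0"
    by (rule assms(2))
  then show ?thesis
    by (simp add: cinner_self)
qed

lemma von_neumann_algebra_diff:
  assumes M: "von_neumann_algebra M" and "x \<in> M" "y \<in> M"
  shows "(\<lambda>\<xi>. x \<xi> - y \<xi>) \<in> M"
proof -
  have add: "(\<lambda>\<xi>. a \<xi> + b \<xi>) \<in> M" if "a \<in> M" "b \<in> M" for a b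
    using M that by (simp add: von_neumann_algebra_def)
  have "(\<lambda>\<xi>. c *\<^sub>C y \<xi>) \<in> M" for c
    using assms by (simp add: von_neumann_algebra_def)
  then have "(\<lambda>\<xi>. x \<xi> + (- 1) *\<^sub>C y \<xi>) \<in> M"
    by (intro add \<open>x \<in> M\<close>)
  moreover have "(- 1) *\<^sub>C a = - a" for a :: 'a
    using scaleR_scaleC[of "- 1" a] by simp
  ultimately show ?thesis
    by simp
qed

text \<open>The operator \<open>x\<close> commutes with \<open>s\<^sup>*\<close> for every \<open>s \<in> M\<close>; taking adjoints, \<open>x\<^sup>*\<close> commutes
  with \<open>s\<close>.\<close>

lemma cadjoint_center_in_commutant:
  assumes M: "von_neumann_algebra M" and x: "x \<in> center M"
  shows "cadjoint x \<in> commutant M"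
proof -
  have clin: "bounded_clinear s" and adj: "cadjoint s \<in> M" if "s \<in> M" for s
    using M that by (auto simp: von_neumann_algebra_def)
  have xM: "x \<in> M" and comm: "\<And>s a. s \<in> M \<Longrightarrow> x (s a) = s (x a)"
    using x by (auto simp: center_def fun_eq_iff)
  have "cadjoint x (s b) = s (cadjoint x b)" if s: "s \<in> M" for s b
  proof (rule cinner_ext_right)
    fix a
    have flip: "cinner (cadjoint s c) d = cinner c (s d)" for c d
      using cinner_cadjoint[OF clin[OF s], of d c]
      by (metis cinner_commute)
    have "cinner a (cadjoint x (s b)) = cinner (cadjoint s (x a)) b"
      by (simp add: cinner_cadjoint[OF clin[OF xM], symmetric] flip)
    also have "\<dots> = cinner (x (cadjoint s a)) b"
      by (simp add: comm adj s)
    also have "\<dots> = cinner a (s (cadjoint x b))"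
      by (simp add: cinner_cadjoint[OF clin[OF xM]] flip)
    finally show "cinner a (cadjoint x (s b)) = cinner a (s (cadjoint x b))" .
  qed
  then show ?thesis
    using clin[OF adj[OF xM]] by (auto simp: commutant_def fun_eq_iff)
qed

theorem lemma3p19:
  fixes M :: "('h::complex_hilbert_space \<Rightarrow> 'h) set"
    and J :: "'h \<Rightarrow> 'h"
    and P :: "'h set"
  assumes "von_neumann_algebra M"
    and "antilinear_isometry J"
    and "J \<circ> J = id"
    and "closed P" and "convex P" and "cone P"
    and "self_dual P"
    and "(\<lambda>x. J \<circ> x \<circ> J) ` M = commutant M"
    and "\<forall>\<xi>\<in>P. J \<xi> = \<xi>"
    and "\<forall>x\<in>M. (x \<circ> J \<circ> x \<circ> J) ` P \<subseteq> P"
  shows "(\<forall>x\<in>center M. J \<circ> x \<circ> J = cadjoint x) \<and> standard_form M J P"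
proof -
  have inv: "J (J a) = a" for a
    using fun_cong[OF \<open>J \<circ> J = id\<close>, of a] by simp
  have "J \<circ> x \<circ> J = cadjoint x" if x: "x \<in> center M" for x
  proof -
    have xM: "x \<in> M"
      using x by (simp add: center_def)
    have clin: "bounded_clinear s" if "s \<in> M" for s
      using assms(1) that by (simp add: von_neumann_algebra_def)
    obtain z where zM: "z \<in> M" and "cadjoint x = J \<circ> z \<circ> J"
      using cadjoint_center_in_commutant[OF assms(1) x] assms(8) by blast
    then have z: "z a = J (cadjoint x (J a))" for a
      by (simp add: inv)
    define y where "y = (\<lambda>\<xi>. x \<xi> - z \<xi>)"
    have yM: "y \<in> M"
      unfolding y_def using assms(1) xM zM by (rule von_neumann_algebra_diff)
    \<comment> \<open>\<open>y\<^sup>* = - J y J\<close>, because \<open>z = J x\<^sup>* J\<close> has adjoint \<open>J x J\<close>.\<close>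
    have y_adj: "cinner (y a) b = - cinner a (J (y (J b)))" for a b
    proof -
      have "cinner (J b) (z (J a)) = cinner (J (x (J (J b)))) (J a)"
        using cadjoint_conjugation[OF assms(2,3) clin[OF xM], of "J b" "J a"]
        by (simp only: z)
      then have "cinner (z a) b = cinner a (J (x (J b)))"
        using cadjoint_conjugation[OF assms(2,3) clin[OF xM], of b a]
        by (metis cinner_commute z)
      moreover have "cinner (x a) b = cinner a (J (z (J b)))"
        by (simp add: cinner_cadjoint[OF clin[OF xM]] z inv)
      moreover have "cinner (y a) b = cnj (cinner b (x a)) - cnj (cinner b (z a))"
        by (subst cinner_commute) (simp add: y_def cinner_diff_right)
      ultimately show ?thesis
        using cinner_commute[of "x a" b] cinner_commute[of "z a" b]
        by (simp add: y_def antilinear_isometry_diff[OF assms(2)] cinner_diff_right)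
    qed
    have vanish: "J (y (J \<xi>)) = 0" if \<xi>: "\<xi> \<in> P" for \<xi>
    proof -
      have "y (J (y (J \<xi>))) \<in> dual_cone P"
        using assms(7,10) yM \<xi> by (auto simp: self_dual_def)
      then have "cinner (y (J (y (J \<xi>)))) \<xi> \<in> \<real>\<^sub>\<ge>\<^sub>0"
        using \<xi> by (simp add: dual_cone_def)
      then have "(norm (J (y (J \<xi>))))\<^sup>2 \<le> 0"
        by (simp add: y_adj cinner_self complex_nonneg_Reals_iff)
      then show ?thesis
        by simp
    qed
    have y0: "y a = 0" for a
    proof (rule orthogonal_self_dual_eq_0[OF assms(7)])
      have "cinner a 0 = 0"
        using cinner_add_right[of a 0 0] by simp
      then show "cinner (y a) \<xi> = 0" if "\<xi> \<in> P" for \<xi>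
        using that by (simp add: y_adj vanish)
    qed
    have "J (x (J a)) = cadjoint x a" for a
      using y0[of "J a"] by (simp add: y_def z inv)
    then show ?thesis
      by (simp add: fun_eq_iff)
  qed
  then show ?thesis
    using assms unfolding standard_form_def by blast
qed

end
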